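(* Let the delays be uniformly bounded, $\sup_{k\in\mathbb N}\max_{i\in\mathcal N}\varphi_i(k)\le\overline\varphi<\infty$ for some $\overline\varphi\in\mathbb N$, let $p_{\min}:=\min_{i\in\mathcal N}p_i$, and suppose $$\overline\varphi<\frac{N\sqrt{p_{\min}}}{2(1-\underline a)}-\frac{1}{2\sqrt{p_{\min}}}.$$ Then, for any $\boldsymbol x(0)\in\boldsymbol\Omega:=\prod_{i=1}^N\Omega_i$, the sequence $(\boldsymbol x(k))_{k\in\mathbb N}$ generated by the asynchronous dynamics $$\boldsymbol x(k+1)=\boldsymbol x(k)+\zeta_k\big(\boldsymbol{\mathrm{prox}}_{\boldsymbol f}(\boldsymbol A\,\hat{\boldsymbol x}(k))-\hat{\boldsymbol x}(k)\big)$$ converges almost surely to some $\bar{\boldsymbol x}\in\mathrm{fix}(\boldsymbol{\mathrm{prox}}_{\boldsymbol f}\circ\boldsymbol A)$, namely a network equilibrium (NWE).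
   Context: Let $\mathcal N=\{1,\dots,N\}$ and $n\ge1$. For each $i\in\mathcal N$, $\Omega_i\subset\mathbb{R}^n$ is nonempty, compact and convex, $\iota_{\Omega_i}$ is its indicator function ($0$ on $\Omega_i$, $+\infty$ elsewhere), and $\bar f_i:=f_i+\iota_{\Omega_i}:\mathbb{R}^n\to\mathbb{R}\cup\{\infty\}$ is proper, lower semicontinuous and convex. The cost of agent $i$ is $g_i(x_i,z):=\bar f_i(x_i)+\frac12\|x_i-z\|^2$. The matrix $A=[a_{i,j}]\in\mathbb{R}^{N\times N}$ is row stochastic ($a_{i,j}\ge0$, $\sum_j a_{i,j}=1$ for all $i$), has positive diagonal, $\underline a:=\min_i a_{i,i}>0$, and its associated digraph is strongly connected. $\boldsymbol A:=A\otimes I_n$. $\mathrm{prox}_{\bar f_i}(x):=\mathrm{argmin}_{y\in\mathbb{R}^n}\,\bar f_i(y)+\frac12\|x-y\|^2$, and $\boldsymbol{\mathrm{prox}}_{\boldsymbol f}(\mathrm{col}(z_1,\dots,z_N)):=\mathrm{col}(\mathrm{prox}_{\bar f_1}(z_1),\dots,\mathrm{prox}_{\bar f_N}(z_N))$. $\mathrm{fix}(T)$ is the set of fixed points of $T$. A vector $\bar{\boldsymbol x}=\mathrm{col}(\bar x_1,\dots,\bar x_N)$ is a network equilibrium (NWE) if $\bar x_i=\mathrm{argmin}_{y\in\mathbb{R}^n}g_i\big(y,\sum_{j=1}^N a_{i,j}\bar x_j\big)$ for every $i\in\mathcal N$; equivalently, $\bar{\boldsymbol x}\in\mathrm{fix}(\boldsymbol{\mathrm{prox}}_{\boldsymbol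 f}\circ\boldsymbol A)$. Asynchronous model. Let $H_i\in\mathbb{R}^{N\times N}$ be the matrix with all entries zero except $[H_i]_{ii}=1$, and $\boldsymbol H_i:=H_i\otimes I_n$. $(\zeta_k)_{k\in\mathbb N}$ are i.i.d. random variables with values in $\{\boldsymbol H_1,\dots,\boldsymbol H_N\}$ and $\mathbb P[\zeta_k=\boldsymbol H_i]=p_i$, where $(p_1,\dots,p_N)$ is a discrete probability distribution (with $p_{\min}>0$, so that the bound makes sense); $\zeta_k=\boldsymbol H_i$ means that at time $k$ agent $i$ is the only one that updates. The vector $\hat{\boldsymbol x}(k)=\mathrm{col}(\hat x_1(k),\dots,\hat x_N(k))$ is the vector of possibly delayed strategies: the strategy of agent $j$ read by the updating agent is $\hat x_j(k)=x_j(k-\varphi_j(k))$, outdated by the delay $\varphi_j(k)\in\mathbb N$ (with $x_j(\ell):=x_j(0)$ for $\ell<0$), except that each agent has always access to the current value of its own strategy, i.e. $\hat x_i(k)=x_i(k)$ for the agent $i$ updating at time $k$. *)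

theory Defs
  imports
    "HOL-Probability.Probability"
    "Graph_Theory.Pair_Digraph"
    "Graph_Theory.Digraph_Component"
begin

text \<open>The set of agents is a finite type \<open>'N\<close>, the strategy space of one agent is
  \<open>real ^ 'n\<close>, and a stacked vector of strategies lives in \<open>real ^ ('N \<times> 'n)\<close>.\<close>

definition col :: "('N::finite \<Rightarrow> real ^ 'n::finite) \<Rightarrow> real ^ ('N \<times> 'n)" where
  "col z = (\<chi> ic. z (fst ic) $ snd ic)"

definition block :: "'N \<Rightarrow> real ^ ('N::finite \<times> 'n::finite) \<Rightarrow> real ^ 'n" where
  "block i x = (\<chi> c. x $ (i, c))"

definition kron :: "real ^ 'a ^ 'b \<Rightarrow> real ^ 'c ^ 'd \<Rightarrow>
    real ^ ('a::finite \<times> 'c::finite) ^ ('b::finite \<times> 'd::finite)" (infixl "\<otimes>\<^sub>K" 70) where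
  "P \<otimes>\<^sub>K Q = (\<chi> r s. P $ fst r $ fst s * Q $ snd r $ snd s)"

definition row_stochastic :: "real ^ 'N ^ 'N::finite \<Rightarrow> bool" where
  "row_stochastic A \<longleftrightarrow> (\<forall>i j. 0 \<le> A $ i $ j) \<and> (\<forall>i. (\<Sum>j\<in>UNIV. A $ i $ j) = 1)"

definition assoc_digraph :: "real ^ 'N ^ 'N::finite \<Rightarrow> 'N pair_pre_digraph" where
  "assoc_digraph A = \<lparr>pverts = UNIV, parcs = {(j, i). 0 < A $ i $ j}\<rparr>"

text \<open>Jensen's inequality is written out in \<open>convex_fun\<close> because \<open>convex_on\<close> covers only
  real-valued functions.\<close>

definition proper_fun :: "('a \<Rightarrow> ereal) \<Rightarrow> bool" where
  "proper_fun h \<longleftrightarrow> (\<forall>y. h y \<noteq> -\<infinity>) \<and> (\<exists>y. h y \<noteq> \<infinity>)"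

definition lsc_fun :: "('a::topological_space \<Rightarrow> ereal) \<Rightarrow> bool" where
  "lsc_fun h \<longleftrightarrow> (\<forall>y. h y \<le> Liminf (at y) h)"

definition convex_fun :: "('a::real_vector \<Rightarrow> ereal) \<Rightarrow> bool" where
  "convex_fun h \<longleftrightarrow> (\<forall>y z. \<forall>t::real. 0 < t \<and> t < 1 \<longrightarrow>
     h ((1 - t) *\<^sub>R y + t *\<^sub>R z) \<le> ereal (1 - t) * h y + ereal t * h z)"

definition indicator_fun :: "'a set \<Rightarrow> 'a \<Rightarrow> ereal" where
  "indicator_fun C y = (if y \<in> C then 0 else \<infinity>)"

definition constrained :: "('a \<Rightarrow> ereal) \<Rightarrow> 'a set \<Rightarrow> 'a \<Rightarrow> ereal" where
  "constrained f C y = f y + indicator_fun C y"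

definition prox :: "(real ^ 'n::finite \<Rightarrow> ereal) \<Rightarrow> real ^ 'n \<Rightarrow> real ^ 'n" where
  "prox h x = (ARG_MIN (\<lambda>y. h y + ereal (1 / 2 * (norm (x - y))\<^sup>2)) y. True)"

definition Prox :: "('N \<Rightarrow> real ^ 'n \<Rightarrow> ereal) \<Rightarrow>
    real ^ ('N::finite \<times> 'n::finite) \<Rightarrow> real ^ ('N \<times> 'n)" where
  "Prox h x = col (\<lambda>i. prox (h i) (block i x))"

definition fixed_points :: "('a \<Rightarrow> 'a) \<Rightarrow> 'a set" where
  "fixed_points T = {x. T x = x}"

definition agent_cost :: "(real ^ 'n::finite \<Rightarrow> ereal) \<Rightarrow> real ^ 'n \<Rightarrow> real ^ 'n \<Rightarrow> ereal" where
  "agent_cost h y z = h y + ereal (1 / 2 * (norm (y - z))\<^sup>2)"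

text \<open>The equation \<open>x\<^sub>i = argmin\<close> is read as: \<open>x\<^sub>i\<close> is the one and only minimiser.\<close>

definition network_equilibrium ::
    "real ^ 'N ^ 'N \<Rightarrow> ('N \<Rightarrow> real ^ 'n \<Rightarrow> ereal) \<Rightarrow> real ^ ('N::finite \<times> 'n::finite) \<Rightarrow> bool" where
  "network_equilibrium A h x \<longleftrightarrow>
     (\<forall>i. {y. is_arg_min (\<lambda>y. agent_cost (h i) y (\<Sum>j\<in>UNIV. A $ i $ j *\<^sub>R block j x)) (\<lambda>_. True) y}
          = {block i x})"

definition select_mat :: "'N \<Rightarrow> real ^ 'N ^ 'N::finite" where
  "select_mat i = (\<chi> r s. if r = i \<and> s = i then 1 else 0)"

definition Select :: "'N \<Rightarrow> real ^ ('N \<times> 'n) ^ ('N::finite \<times> 'n::finite)" where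
  "Select i = select_mat i \<otimes>\<^sub>K mat 1"

text \<open>The state read at time \<open>k\<close>: the agent that updates at time \<open>k\<close> (the \<open>j\<close> with
  \<open>\<zeta> k \<omega> = Select j\<close>) reads its own current strategy, and delayed strategies of all the others.
  Truncated subtraction implements the convention that times before \<open>0\<close> refer to
  the initial state.\<close>

definition read_state ::
    "(nat \<Rightarrow> 'w \<Rightarrow> real ^ ('N \<times> 'n) ^ ('N \<times> 'n)) \<Rightarrow> ('N \<Rightarrow> nat \<Rightarrow> 'w \<Rightarrow> nat) \<Rightarrow>
     (nat \<Rightarrow> 'w \<Rightarrow> real ^ ('N \<times> 'n)) \<Rightarrow> nat \<Rightarrow> 'w \<Rightarrow> real ^ ('N::finite \<times> 'n::finite)" where
  "read_state \<zeta> \<phi> x k \<omega> =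
     col (\<lambda>j. if \<zeta> k \<omega> = Select j then block j (x k \<omega>) else block j (x (k - \<phi> j k \<omega>) \<omega>))"

text \<open>The delay bound is stated in \<open>ereal\<close> because a single agent forces \<open>a_min = 1\<close>: there
  the quotient is \<open>\<infinity>\<close>, whereas division by zero in \<open>real\<close> would make the bound unsatisfiable.\<close>

definition delay_bound :: "nat \<Rightarrow> real \<Rightarrow> real \<Rightarrow> ereal" where
  "delay_bound N a_min p_min =
     ereal (real N * sqrt p_min) / ereal (2 * (1 - a_min)) - ereal (1 / (2 * sqrt p_min))"

end

theory Submission
  imports Defs
begin

text \<open>The proof works along single trajectories. Randomness enters through one fact: almost surely,
  every finite sequence of updating agents occurs infinitely often
  (\<open>word_occurs_infinitely_often\<close>).

  The response of agent \<open>i\<close> to a state is \<open>prox (fbar i)\<close> of a convex combination of the strategies,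
  so it is nonexpansive when states are compared by the maximum over the agents of the Euclidean
  distance of their strategies. A single agent replacing its strategy by a response to outdated data
  therefore cannot increase the largest distance to a fixed equilibrium \<open>xs\<close>, taken over all agents
  and over the window of the last \<open>\<phi>_max\<close> steps (\<open>window_error_decseq\<close>). An equilibrium exists by
  Brouwer's theorem (\<open>stacked_fixed_point_exists\<close>). Once some subsequence of windows converges to
  a state that is itself an equilibrium, monotonicity of the window error for this new equilibrium
  gives convergence of the whole trajectory.

  To find such a subsequence, consider the word in which the agents take turns, each updating
  \<open>\<phi>_max + 1\<close> times in a row; at the last update of such a turn all readings are current
  (\<open>reads_fresh\<close>). By compactness, the pieces of trajectory that follow the word have a limit, and in
  this limit run the window error no longer drops. That is a rigid situation
  (\<open>extreme_run_rests_at_equilibrium\<close>). An agent whose distance to \<open>xs\<close> is below the maximum stays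
  below it, because it weighs its own current strategy with a positive coefficient. An agent that
  keeps the maximal distance through an update meets the equality case of firm nonexpansiveness and
  of strict convexity of the Euclidean norm, so everyone it listens to has the same error vector.
  Strong connectivity spreads this vector \<open>e\<close> over the network, and the limit run stands
  still at \<open>xs + e\<close>, which is thus an equilibrium.\<close>

section \<open>Proximal maps\<close>

lemma lsc_fun_eventually_greater:
  assumes "lsc_fun h" "c < h y"
  shows "eventually (\<lambda>z. c < h z) (nhds y)"
  using assms less_LiminfD[of c "at y" h]
  by (auto simp: lsc_fun_def eventually_nhds_conv_at intro: less_le_trans)

lemma lsc_fun_add_continuous:
  fixes h :: "'a::t2_space \<Rightarrow> ereal" and q :: "'a \<Rightarrow> real"
  assumes lsc: "lsc_fun h" and q: "isCont q y" and c: "c < h y + ereal (q y)"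
  shows "eventually (\<lambda>z. c < h z + ereal (q z)) (nhds y)"
proof -
  obtain r where r: "c < ereal r" "ereal r < h y + ereal (q y)"
    using ereal_dense2[OF c] by auto
  have "ereal (r - q y) < h y"
    using r(2) by (cases "h y") auto
  then obtain s where s: "ereal (r - q y) < ereal s" "ereal s < h y"
    using ereal_dense2 by blast
  have "eventually (\<lambda>z. ereal s < h z) (nhds y)"
    using lsc_fun_eventually_greater[OF lsc s(2)] .
  moreover have "eventually (\<lambda>z. q z > r - s) (nhds y)"
    using q s(1) by (intro order_tendstoD(1)[of q "q y"]) (auto simp: isCont_def tendsto_at_iff_tendsto_nhds)
  ultimately show ?thesis
  proof eventually_elim
    case (elim z)
    have "ereal r < h z + ereal (q z)"
      using elim by (cases "h z") auto
    with r(1) show ?case by (rule less_trans)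
  qed
qed

text \<open>Weierstrass' theorem for extended-valued functions. If no point were minimal, the open
  superlevel sets \<open>{z. F v < F z}\<close> would cover the compact set; the least \<open>F v\<close> in a finite
  subcover would then lie strictly above another one.\<close>

lemma lsc_attains_min:
  fixes F :: "'a::topological_space \<Rightarrow> ereal"
  assumes C: "compact C" and outside: "\<And>y. y \<notin> C \<Longrightarrow> F y = \<infinity>" and fin: "\<exists>y. F y \<noteq> \<infinity>"
    and lsc: "\<And>y c. c < F y \<Longrightarrow> eventually (\<lambda>z. c < F z) (nhds y)"
  shows "\<exists>u. \<forall>y. F u \<le> F y"
proof (rule ccontr)
  assume "\<not> ?thesis"
  then have lower: "\<exists>v. F v < F y" for y by (auto simp: not_le)
  define U where "U v = interior {z. F v < F z}" for v
  have cover: "C \<subseteq> (\<Union>v\<in>UNIV. U v)"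
  proof
    fix y assume "y \<in> C"
    obtain v where "F v < F y" using lower by blast
    then have "y \<in> U v"
      using lsc[of "F v" y] by (auto simp: U_def interior_def eventually_nhds)
    then show "y \<in> (\<Union>v\<in>UNIV. U v)" by blast
  qed
  obtain D where D: "finite D" "C \<subseteq> (\<Union>v\<in>D. U v)"
    using compactE_image[OF C _ cover] by (auto simp: U_def)
  have below: "\<exists>v\<in>D. F v < F y" if "F y \<noteq> \<infinity>" for y
    using that outside[of y] D(2) by (force simp: U_def dest: interior_subset[THEN subsetD])
  have "D \<noteq> {}" using fin below by blast
  then obtain v where v: "v \<in> D" "\<And>w. w \<in> D \<Longrightarrow> F v \<le> F w"
    using ex_is_arg_min_if_finite[OF D(1), of F] by (auto simp: is_arg_min_linorder)
  have "F v \<noteq> \<infinity>"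
  proof -
    obtain y w where "w \<in> D" "F w < F y" using fin below by blast
    then show ?thesis using v(2)[of w] by auto
  qed
  then obtain w where "w \<in> D" "F w < F v" using below by blast
  then show False using v(2)[of w] by auto
qed

text \<open>\<^const>\<open>prox\<close> picks its value by the choice operator, so the existence of a minimiser is what
  makes it one.\<close>

lemma prox_minimises_objective:
  fixes h :: "real ^ 'n::finite \<Rightarrow> ereal"
  assumes "proper_fun h" "lsc_fun h" "compact C" "\<And>y. y \<notin> C \<Longrightarrow> h y = \<infinity>"
  shows "h (prox h z) + ereal (1 / 2 * (norm (z - prox h z))\<^sup>2) \<le> h y + ereal (1 / 2 * (norm (z - y))\<^sup>2)"
proof -
  let ?F = "\<lambda>y. h y + ereal (1 / 2 * (norm (z - y))\<^sup>2)"
  have "\<exists>u. \<forall>y. ?F u \<le> ?F y"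
  proof (rule lsc_attains_min)
    show "\<exists>y. ?F y \<noteq> \<infinity>" using assms(1) by (auto simp: proper_fun_def)
    show "eventually (\<lambda>z. c < ?F z) (nhds y)" if "c < ?F y" for c y
      using that by (intro lsc_fun_add_continuous assms(2)) (auto intro!: continuous_intros)
  qed (use assms in auto)
  then obtain u where "is_arg_min ?F (\<lambda>_. True) u" by (auto simp: is_arg_min_linorder)
  then have "is_arg_min ?F (\<lambda>_. True) (prox h z)"
    unfolding prox_def arg_min_def by (rule someI)
  then show ?thesis by (auto simp: is_arg_min_linorder)
qed

text \<open>This is the optimality condition that \<open>z - u\<close> is a subgradient of \<open>h\<close> at \<open>u\<close>: compare \<open>u\<close>
  with a point slightly moved towards \<open>y\<close>, bound \<open>h\<close> there by convexity, divide by the step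
  \<open>t\<close> and let \<open>t\<close> tend to \<open>0\<close>.\<close>

lemma prox_variational_inequality:
  fixes h :: "'a::real_inner \<Rightarrow> ereal"
  assumes cvx: "convex_fun h" and proper: "proper_fun h"
    and u: "\<And>y. h u + ereal (1 / 2 * (norm (z - u))\<^sup>2) \<le> h y + ereal (1 / 2 * (norm (z - y))\<^sup>2)"
  shows "h u + ereal (inner (z - u) (y - u)) \<le> h y"
proof (cases "h y")
  case (real b)
  have "h u \<noteq> \<infinity>" using u[of y] real by auto
  moreover have "h u \<noteq> -\<infinity>" using proper by (auto simp: proper_fun_def)
  ultimately obtain a where a: "h u = ereal a" by (cases "h u") auto
  let ?c = "inner (z - u) (y - u)"
  have *: "a - b + ?c \<le> t / 2 * (norm (y - u))\<^sup>2" if t: "0 < t" "t < 1" for t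
  proof -
    let ?v = "(1 - t) *\<^sub>R u + t *\<^sub>R y"
    have "h ?v \<le> ereal (1 - t) * h u + ereal t * h y"
      using cvx t by (auto simp: convex_fun_def)
    then have "h ?v \<le> ereal ((1 - t) * a + t * b)" by (simp add: a real)
    then have "h u + ereal (1 / 2 * (norm (z - u))\<^sup>2)
        \<le> ereal ((1 - t) * a + t * b) + ereal (1 / 2 * (norm (z - ?v))\<^sup>2)"
      by (intro order.trans[OF u[of ?v]] add_right_mono)
    then have "a + 1 / 2 * (norm (z - u))\<^sup>2 \<le> (1 - t) * a + t * b + 1 / 2 * (norm (z - ?v))\<^sup>2"
      by (simp add: a)
    moreover have "(norm (z - ?v))\<^sup>2 = (norm (z - u))\<^sup>2 - 2 * t * ?c + t\<^sup>2 * (norm (y - u))\<^sup>2"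
    proof -
      have "(norm (v - t *\<^sub>R w))\<^sup>2 = (norm v)\<^sup>2 - 2 * t * inner v w + t\<^sup>2 * (norm w)\<^sup>2" for v w :: 'a
        unfolding power2_norm_eq_inner
        by (simp add: inner_diff_left inner_diff_right inner_commute power2_eq_square algebra_simps)
      from this[of "z - u" "y - u"] show ?thesis by (simp add: algebra_simps)
    qed
    ultimately have "t * (a - b + ?c) \<le> t * (t / 2 * (norm (y - u))\<^sup>2)"
      by (simp add: algebra_simps power2_eq_square)
    then show ?thesis using t(1) by simp
  qed
  have "a - b + ?c \<le> 0"
  proof (rule tendsto_lowerbound)
    show "((\<lambda>t. t / 2 * (norm (y - u))\<^sup>2) \<longlongrightarrow> 0) (at_right 0)"
      by (auto intro!: tendsto_eq_intros)
    show "eventually (\<lambda>t. a - b + ?c \<le> t / 2 * (norm (y - u))\<^sup>2) (at_right 0)"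
      unfolding eventually_at_right_field using * by (intro exI[of _ 1]) auto
  qed auto
  then show ?thesis by (simp add: a real)
next
  case MInf
  then show ?thesis using proper by (auto simp: proper_fun_def)
qed auto

text \<open>The subdifferential is monotone: test the inequality of each point at the other point and add.
  With \<open>y = z\<close> this gives uniqueness of the minimiser, in general firm nonexpansiveness.\<close>

lemma prox_points_firm:
  fixes h :: "'a::real_inner \<Rightarrow> ereal"
  assumes fin: "\<bar>h u\<bar> \<noteq> \<infinity>" "\<bar>h v\<bar> \<noteq> \<infinity>"
    and u: "\<And>w. h u + ereal (inner (y - u) (w - u)) \<le> h w"
    and v: "\<And>w. h v + ereal (inner (z - v) (w - v)) \<le> h w"
  shows "(norm (u - v))\<^sup>2 \<le> inner (u - v) (y - z)"
proof -
  obtain a b where ab: "h u = ereal a" "h v = ereal b" using fin by auto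
  have "inner (y - u) (v - u) + inner (z - v) (u - v) \<le> 0"
    using u[of v] v[of u] by (simp add: ab)
  then show ?thesis
    by (simp add: power2_norm_eq_inner inner_diff_left inner_diff_right inner_commute algebra_simps)
qed

locale prox_function =
  fixes h :: "real ^ 'n::finite \<Rightarrow> ereal" and C :: "(real ^ 'n) set"
  assumes proper: "proper_fun h" and lsc: "lsc_fun h" and cvx: "convex_fun h"
    and compact: "compact C" and outside: "\<And>y. y \<notin> C \<Longrightarrow> h y = \<infinity>"
begin

lemma prox_min:
  "h (prox h z) + ereal (1 / 2 * (norm (z - prox h z))\<^sup>2) \<le> h y + ereal (1 / 2 * (norm (z - y))\<^sup>2)"
  using proper lsc compact outside by (rule prox_minimises_objective)

lemma prox_finite: "\<bar>h (prox h z)\<bar> \<noteq> \<infinity>"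
proof -
  obtain y where "h y \<noteq> \<infinity>" using proper by (auto simp: proper_fun_def)
  then have "h (prox h z) \<noteq> \<infinity>" using prox_min[of z y] by auto
  moreover have "h (prox h z) \<noteq> -\<infinity>" using proper by (auto simp: proper_fun_def)
  ultimately show ?thesis by auto
qed

lemma prox_in: "prox h z \<in> C"
  using prox_finite[of z] outside by force

lemma prox_variational: "h (prox h z) + ereal (inner (z - prox h z) (y - prox h z)) \<le> h y"
  by (rule prox_variational_inequality[OF cvx proper prox_min])

lemma prox_firmly_nonexpansive:
  "(norm (prox h y - prox h z))\<^sup>2 \<le> inner (prox h y - prox h z) (y - z)"
  by (intro prox_points_firm[of h] prox_finite prox_variational)

lemma agent_cost_minimisers:
  "{y. is_arg_min (\<lambda>y. agent_cost h y z) (\<lambda>_. True) y} = {prox h z}"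
proof -
  let ?F = "\<lambda>y. h y + ereal (1 / 2 * (norm (z - y))\<^sup>2)"
  have "agent_cost h y z = ?F y" for y by (simp add: agent_cost_def norm_minus_commute)
  moreover have "u = prox h z" if u: "\<And>y. ?F u \<le> ?F y" for u
  proof -
    have "h u \<noteq> \<infinity>" using u[of "prox h z"] prox_finite[of z] by auto
    then have "\<bar>h u\<bar> \<noteq> \<infinity>" using proper by (auto simp: proper_fun_def)
    then have "(norm (u - prox h z))\<^sup>2 \<le> inner (u - prox h z) (z - z)"
      by (rule prox_points_firm[OF _ prox_finite prox_variational_inequality[OF cvx proper u] prox_variational])
    then show ?thesis by simp
  qed
  ultimately show ?thesis using prox_min[of z] by (auto simp: is_arg_min_linorder)
qed

end

section \<open>Equality cases for nonexpansive maps and averages\<close>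

lemma firmly_nonexpansive_imp_nonexpansive:
  fixes u v :: "'a::real_inner"
  assumes "(norm u)\<^sup>2 \<le> inner u v"
  shows "norm u \<le> norm v"
proof -
  have "norm u * norm u \<le> norm u * norm v"
    using assms norm_cauchy_schwarz[of u v] by (simp add: power2_eq_square)
  then show ?thesis by (cases "norm u = 0") auto
qed

text \<open>Read \<open>v\<close> as the difference of two points and \<open>u\<close> as the difference of their images: a firmly
  nonexpansive map can preserve a distance only by translating the two points, whereas a rotation
  is nonexpansive and preserves all distances.\<close>

lemma firmly_nonexpansive_norm_eq:
  fixes u v :: "'a::real_inner"
  assumes firm: "(norm u)\<^sup>2 \<le> inner u v" and le: "norm v \<le> norm u"
  shows "u = v"
proof -
  have "(norm v)\<^sup>2 \<le> (norm u)\<^sup>2" using le by (simp add: power_mono)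
  then have "(norm (u - v))\<^sup>2 \<le> 0"
    using firm by (simp add: power2_norm_eq_inner inner_diff_left inner_diff_right inner_commute)
  then show ?thesis by simp
qed

lemma norm_convex_combination_le:
  fixes e :: "'i \<Rightarrow> 'a::real_normed_vector"
  assumes "finite I" "\<And>j. j \<in> I \<Longrightarrow> 0 \<le> w j" "sum w I = 1" "\<And>j. j \<in> I \<Longrightarrow> norm (e j) \<le> c"
  shows "norm (\<Sum>j\<in>I. w j *\<^sub>R e j) \<le> c"
proof -
  have "norm (\<Sum>j\<in>I. w j *\<^sub>R e j) \<le> (\<Sum>j\<in>I. w j * c)"
    using assms by (intro sum_norm_le) (simp add: mult_left_mono)
  then show ?thesis using assms(3) by (simp flip: sum_distrib_right)
qed

lemma norm_convex_combination_less:
  fixes e :: "'i \<Rightarrow> 'a::real_normed_vector"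
  assumes "finite I" "\<And>j. j \<in> I \<Longrightarrow> 0 \<le> w j" "sum w I = 1" "\<And>j. j \<in> I \<Longrightarrow> norm (e j) \<le> c"
    and i: "i \<in> I" "0 < w i" "norm (e i) < c"
  shows "norm (\<Sum>j\<in>I. w j *\<^sub>R e j) < c"
proof -
  have "norm (\<Sum>j\<in>I. w j *\<^sub>R e j) \<le> (\<Sum>j\<in>I. w j * norm (e j))"
    using assms by (intro sum_norm_le) simp
  also have "\<dots> < (\<Sum>j\<in>I. w j * c)"
    using assms by (intro sum_strict_mono_ex1) (auto intro!: mult_left_mono bexI[of _ i])
  finally show ?thesis using assms(3) by (simp flip: sum_distrib_right)
qed

text \<open>Strict convexity of the ball of an inner product space: a point of maximal norm is not a proper average of other
  points of the ball. The defects \<open>c * c - inner (e j) v\<close> are nonnegative and average to zero, so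
  each one with positive weight vanishes, which is the equality case of Cauchy-Schwarz.\<close>

lemma convex_combination_extreme:
  fixes e :: "'i \<Rightarrow> 'a::real_inner"
  assumes "finite I" "\<And>j. j \<in> I \<Longrightarrow> 0 \<le> w j" "sum w I = 1" "\<And>j. j \<in> I \<Longrightarrow> norm (e j) \<le> c"
    and v: "(\<Sum>j\<in>I. w j *\<^sub>R e j) = v" "c \<le> norm v" and j: "j \<in> I" "0 < w j"
  shows "e j = v"
proof -
  have c: "norm v = c"
    using norm_convex_combination_le[of I w e c] assms(1-4) v by auto
  have le: "inner (e l) v \<le> c * c" if "l \<in> I" for l
    using norm_cauchy_schwarz[of "e l" v] assms(4)[OF that] mult_right_mono[of "norm (e l)" c "norm v"] c
    by (auto intro: order.trans)
  have "c * c = (\<Sum>l\<in>I. w l * inner (e l) v)"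
  proof -
    have "c * c = inner (\<Sum>l\<in>I. w l *\<^sub>R e l) v"
      using c v(1) by (metis norm_eq_square power2_norm_eq_inner power2_eq_square)
    then show ?thesis by (simp add: inner_sum_left)
  qed
  then have "(\<Sum>l\<in>I. w l * (c * c - inner (e l) v)) = 0"
    using assms(3) by (simp add: algebra_simps sum_subtractf flip: sum_distrib_right)
  then have "w j * (c * c - inner (e j) v) = 0"
    using assms(1,2) le j(1) by (subst (asm) sum_nonneg_eq_0_iff) (auto simp: mult_nonneg_nonneg)
  then have "(norm v)\<^sup>2 \<le> inner v (e j)"
    using j(2) c by (simp add: power2_eq_square inner_commute)
  then show ?thesis
    using firmly_nonexpansive_norm_eq[of v "e j"] assms(4)[OF j(1)] c by auto
qed

section \<open>Networks of firmly nonexpansive maps\<close>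

text \<open>The maps \<open>P i\<close> stand for the proximal maps and \<open>a\<close> for the weights of the network. The last
  assumption says that every agent influences every other one along a path of positive weights.\<close>

locale proximal_network =
  fixes P :: "'N::finite \<Rightarrow> 'a::euclidean_space \<Rightarrow> 'a" and a :: "'N \<Rightarrow> 'N \<Rightarrow> real"
  assumes firm: "\<And>i y z. (norm (P i y - P i z))\<^sup>2 \<le> inner (P i y - P i z) (y - z)"
    and weight_nonneg: "\<And>i j. 0 \<le> a i j"
    and weight_sum: "\<And>i. (\<Sum>j\<in>UNIV. a i j) = 1"
    and weight_diag: "\<And>i. 0 < a i i"
    and connected: "\<And>i j. (i, j) \<in> {(j, i). 0 < a i j}\<^sup>*"
begin

definition response :: "'N \<Rightarrow> ('N \<Rightarrow> 'a) \<Rightarrow> 'a" where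
  "response i z = P i (\<Sum>j\<in>UNIV. a i j *\<^sub>R z j)"

definition equilibrium :: "('N \<Rightarrow> 'a) \<Rightarrow> bool" where
  "equilibrium z \<longleftrightarrow> (\<forall>i. response i z = z i)"

lemma P_nonexpansive: "norm (P i y - P i z) \<le> norm (y - z)"
  by (rule firmly_nonexpansive_imp_nonexpansive[OF firm])

lemma continuous_on_P: "continuous_on UNIV (P i)"
proof -
  have "1-lipschitz_on UNIV (P i)"
    using P_nonexpansive by (intro lipschitz_onI) (auto simp: dist_norm)
  then show ?thesis by (rule lipschitz_on_continuous_on)
qed

lemma weighted_diff:
  fixes y z :: "'N \<Rightarrow> 'a"
  shows "(\<Sum>j\<in>UNIV. a i j *\<^sub>R y j) - (\<Sum>j\<in>UNIV. a i j *\<^sub>R z j) = (\<Sum>j\<in>UNIV. a i j *\<^sub>R (y j - z j))"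
  by (simp add: scaleR_right_diff_distrib sum_subtractf)

lemma response_diff_le:
  assumes "\<And>j. norm (y j - z j) \<le> c"
  shows "norm (response i y - response i z) \<le> c"
  unfolding response_def
  by (rule order.trans[OF P_nonexpansive], unfold weighted_diff)
     (intro norm_convex_combination_le weight_nonneg weight_sum assms finite)

text \<open>Here the positive diagonal acts: an agent reading its own strategy with an error below the
  maximum cannot be pulled back to the maximum by the others.\<close>

lemma response_diff_less:
  assumes "\<And>j. norm (y j - z j) \<le> c" "norm (y i - z i) < c"
  shows "norm (response i y - response i z) < c"
  unfolding response_def
  by (rule order.strict_trans1[OF P_nonexpansive], unfold weighted_diff)
     (rule norm_convex_combination_less[where i = i], use weight_nonneg weight_sum weight_diag assms in auto)

text \<open>If the response keeps the maximal error, both steps are tight: the proximal map translates, and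
  the averaged errors coincide. So every agent that \<open>i\<close> listens to has the same error vector.\<close>

lemma response_diff_extreme:
  assumes le: "\<And>j. norm (y j - z j) \<le> c" and ge: "c \<le> norm (response i y - response i z)"
    and j: "0 < a i j"
  shows "y j - z j = response i y - response i z"
proof -
  let ?s = "(\<Sum>j\<in>UNIV. a i j *\<^sub>R y j) - (\<Sum>j\<in>UNIV. a i j *\<^sub>R z j)"
  have "norm ?s \<le> c"
    unfolding weighted_diff by (intro norm_convex_combination_le weight_nonneg weight_sum le finite)
  then have s: "response i y - response i z = ?s"
    using ge unfolding response_def by (intro firmly_nonexpansive_norm_eq[OF firm]) auto
  show ?thesis
    by (rule convex_combination_extreme[where I = UNIV and w = "a i"])
       (use weight_nonneg weight_sum le ge j s in \<open>auto simp flip: weighted_diff\<close>)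
qed

lemma error_stays_below:
  assumes eq: "equilibrium xs"
    and step: "\<And>t j. t < T \<Longrightarrow> Y (Suc t) j = (if j = u t then response j (R t) else Y t j)"
    and own: "\<And>t. t < T \<Longrightarrow> R t (u t) = Y t (u t)"
    and bound: "\<And>t j. t < T \<Longrightarrow> norm (R t j - xs j) \<le> c"
    and t: "t \<le> t'" "t' \<le> T" and below: "norm (Y t j - xs j) < c"
  shows "norm (Y t' j - xs j) < c"
  using t
proof (induction t' rule: dec_induct)
  case (step s)
  then have s: "s < T" "norm (Y s j - xs j) < c" by auto
  show ?case
  proof (cases "j = u s")
    case True
    then have "norm (response j (R s) - response j xs) < c"
      using s own bound by (intro response_diff_less) auto
    then show ?thesis using True s(1) assms(2) eq by (simp add: equilibrium_def)
  qed (use s assms(2) in auto)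
qed (simp add: below)

text \<open>A run in which the maximal error \<open>c\<close> never drops is at rest during some sweep. The set \<open>S\<close> of
  agents at error \<open>c\<close> can only shrink and stays nonempty, hence among \<open>CARD('N)\<close> sweeps of length
  \<open>p\<close> there is one during which it is constant. In that sweep, agents of \<open>S\<close> do not move when they
  update, and at a moment with undelayed readings they force their in-neighbours to have the same
  error vector, so to belong to \<open>S\<close> as well. By strong connectivity all errors equal one vector
  \<open>e\<close>, nobody moves, and since everybody has updated from the current state, that state
  \<open>xs + e\<close> is an equilibrium.\<close>

lemma extreme_run_rests_at_equilibrium:
  fixes p :: nat
  assumes eq: "equilibrium xs"
    and step: "\<And>t j. t < T \<Longrightarrow> Y (Suc t) j = (if j = u t then response j (R t) else Y t j)"
    and own: "\<And>t. t < T \<Longrightarrow> R t (u t) = Y t (u t)"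
    and bound: "\<And>t j. t < T \<Longrightarrow> norm (R t j - xs j) \<le> c" "\<And>t j. t \<le> T \<Longrightarrow> norm (Y t j - xs j) \<le> c"
    and fresh: "\<And>s i. s < CARD('N) \<Longrightarrow> \<exists>t. s * p \<le> t \<and> t < Suc s * p \<and> u t = i \<and> R t = Y t"
    and T: "CARD('N) * p \<le> T"
    and top: "\<exists>t j. CARD('N) * p \<le> t \<and> t \<le> T \<and> c \<le> norm (Y t j - xs j)"
  shows "\<exists>s<CARD('N). equilibrium (Y (s * p)) \<and> (\<forall>t\<in>{s * p..Suc s * p}. Y t = Y (s * p))"
proof -
  define S where "S t = {j. c \<le> norm (Y t j - xs j)}" for t
  have S_anti: "S t' \<subseteq> S t" if "t \<le> t'" "t' \<le> T" for t t'
    using error_stays_below[where Y = Y and R = R and u = u and xs = xs and T = T and c = c, OF eq step own bound(1) that] by (auto simp: S_def not_less[symmetric])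
  have S_nonempty: "S t \<noteq> {}" if "t \<le> CARD('N) * p" for t
  proof -
    obtain t' where "CARD('N) * p \<le> t'" "t' \<le> T" "S t' \<noteq> {}"
      using top by (auto simp: S_def)
    then show ?thesis using S_anti[of t t'] that by auto
  qed
  have le_T: "s * p \<le> T" if "s \<le> CARD('N)" for s
    using that T by (meson mult_le_mono1 order.trans)
  have "\<exists>s<CARD('N). S (s * p) = S (Suc s * p)"
  proof (rule ccontr)
    assume no: "\<not> ?thesis"
    have drop: "card (S (Suc s * p)) < card (S (s * p))" if "s < CARD('N)" for s
      using no that S_anti[of "s * p" "Suc s * p"] le_T[of "Suc s"]
      by (intro psubset_card_mono) auto
    \<comment> \<open>A strict loss in every sweep would exhaust all agents.\<close>
    have "card (S (s * p)) + s \<le> CARD('N)" if "s \<le> CARD('N)" for s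
      using that
    proof (induction s)
      case (Suc s)
      then show ?case using drop[of s] by simp
    qed (simp add: card_mono)
    from this[of "CARD('N)"] show False
      using S_nonempty[of "CARD('N) * p"] by (simp add: card_gt_0_iff)
  qed
  then obtain s where s: "s < CARD('N)" "S (s * p) = S (Suc s * p)" by blast
  let ?I = "{s * p..Suc s * p}"
  have I_T: "t \<le> T" if "t \<in> ?I" for t
    using that le_T[of "Suc s"] s(1) by auto
  have S_const: "S t = S (s * p)" if "t \<in> ?I" for t
    using S_anti[of "s * p" t] S_anti[of t "Suc s * p"] that s(2) I_T[of t] le_T[of "Suc s"] s(1)
    by (simp add: subset_antisym)
  have extreme: "R t l - xs l = Y (Suc t) (u t) - xs (u t)"
    if t: "s * p \<le> t" "t < Suc s * p" and ut: "u t \<in> S (s * p)" and l: "0 < a (u t) l" for t l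
  proof -
    have tT: "t < T" using t I_T[of "Suc t"] by auto
    have "u t \<in> S (Suc t)" using S_const[of "Suc t"] t ut by auto
    then have "c \<le> norm (response (u t) (R t) - response (u t) xs)"
      using tT step eq by (simp add: S_def equilibrium_def)
    then have "R t l - xs l = response (u t) (R t) - response (u t) xs"
      by (intro response_diff_extreme[OF bound(1)[OF tT] _ l])
    then show ?thesis using tT step eq by (simp add: equilibrium_def)
  qed
  have const: "Y t j = Y (s * p) j" if "t \<in> ?I" "j \<in> S (s * p)" for t j
  proof -
    have "s * p \<le> t" using that by simp
    then show ?thesis using that(1)
    proof (induction t rule: dec_induct)
      case (step t)
      then have t: "s * p \<le> t" "t < Suc s * p" "t < T" using I_T[of "Suc t"] by auto
      show ?case
      proof (cases "j = u t")
        case True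
        then show ?thesis
          using extreme[of t j] t that(2) weight_diag own step.IH by auto
      qed (use t step.IH assms(2) in auto)
    qed simp
  qed
  obtain j0 where j0: "j0 \<in> S (s * p)"
    using S_nonempty[of "s * p"] s(1) by auto
  define e where "e = Y (s * p) j0 - xs j0"
  have spread: "l \<in> S (s * p) \<and> Y (s * p) l - xs l = Y (s * p) i - xs i"
    if i: "i \<in> S (s * p)" and l: "0 < a i l" for i l
  proof -
    obtain t where t: "s * p \<le> t" "t < Suc s * p" "u t = i" "R t = Y t"
      using fresh[OF s(1)] by blast
    then have "Y t l - xs l = Y (Suc t) i - xs i"
      using extreme[of t l] i l by simp
    also have "\<dots> = Y (s * p) i - xs i"
      using const[of "Suc t" i] t i by simp
    finally have *: "Y t l - xs l = Y (s * p) i - xs i" .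
    then have "l \<in> S t" using i by (simp add: S_def)
    then have "l \<in> S (s * p)" using S_const[of t] t by simp
    then show ?thesis using * const[of t l] t by simp
  qed
  have all: "j \<in> S (s * p) \<and> Y (s * p) j - xs j = e" for j
    using connected[of j j0]
  proof (induction rule: converse_rtrancl_induct)
    case base
    show ?case using j0 e_def by simp
  next
    case (step y z)
    then show ?case using spread[of z y] by simp
  qed
  have rest: "Y t = Y (s * p)" if "t \<in> ?I" for t
    using const[OF that] all by auto
  have "response i (Y (s * p)) = Y (s * p) i" for i
  proof -
    obtain t where t: "s * p \<le> t" "t < Suc s * p" "u t = i" "R t = Y t"
      using fresh[OF s(1)] by blast
    have "Y (Suc t) i = response i (R t)"
      using step[of t i] t I_T[of "Suc t"] by simp
    then show ?thesis using rest[of t] rest[of "Suc t"] t by simp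
  qed
  then show ?thesis using rest s(1) unfolding equilibrium_def by blast
qed

end

section \<open>Convergence of asynchronous runs\<close>

lemma finite_family_convergent_subsequence:
  fixes Z :: "nat \<Rightarrow> 'i \<Rightarrow> 'a::heine_borel"
  assumes "finite S" "\<And>s. s \<in> S \<Longrightarrow> bounded (range (\<lambda>m. Z m s))"
  shows "\<exists>l r. strict_mono (r :: nat \<Rightarrow> nat) \<and> (\<forall>s\<in>S. (\<lambda>m. Z (r m) s) \<longlonglongrightarrow> l s)"
  using assms
proof (induction S)
  case empty
  show ?case by (intro exI[of _ undefined] exI[of _ id]) (auto simp: strict_mono_id)
next
  case (insert s S)
  then obtain l r where r: "strict_mono r" "\<forall>s\<in>S. (\<lambda>m. Z (r m) s) \<longlonglongrightarrow> l s" by auto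
  have "bounded (range (\<lambda>m. Z (r m) s))"
    using insert.prems by (auto intro: bounded_subset)
  then obtain l' r' where r': "strict_mono r'" "((\<lambda>m. Z (r m) s) \<circ> r') \<longlonglongrightarrow> l'"
    using bounded_imp_convergent_subsequence by blast
  have "\<forall>t\<in>insert s S. (\<lambda>m. Z ((r \<circ> r') m) t) \<longlonglongrightarrow> (l(s := l')) t"
    using r(2) r' insert.hyps(2) LIMSEQ_subseq_LIMSEQ[OF _ r'(1)] by (fastforce simp: o_def)
  then show ?case using strict_mono_o[OF r(1) r'(1)] by blast
qed

text \<open>The schedule that visits the agents cyclically and stays \<open>L\<close> steps at each one; one sweep takes
  \<open>L * CARD('N)\<close> steps.\<close>

definition sweep :: "nat \<Rightarrow> nat \<Rightarrow> 'N::finite" where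
  "sweep L t = from_nat_into UNIV ((t div L) mod CARD('N))"

lemma sweep_visits_all:
  fixes i :: "'N::finite"
  assumes "0 < L"
  shows "\<exists>b. s * (L * CARD('N)) \<le> b \<and> b + L \<le> Suc s * (L * CARD('N)) \<and> (\<forall>r<L. sweep L (b + r) = i)"
proof -
  obtain q where q: "q < CARD('N)" "from_nat_into UNIV q = i"
    using bij_betw_from_nat_into_finite[OF finite[of "UNIV :: 'N set"]]
    by (metis UNIV_I bij_betw_iff_bijections lessThan_iff)
  define b where "b = L * (s * CARD('N) + q)"
  have "sweep L (b + r) = i" if "r < L" for r
  proof -
    have "(b + r) div L = s * CARD('N) + q" using that by (simp add: b_def)
    then show ?thesis using q by (simp add: sweep_def)
  qed
  moreover have "b + L \<le> Suc s * (L * CARD('N))"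
  proof -
    have "L * Suc q \<le> L * CARD('N)" using q(1) by (intro mult_le_mono2) simp
    then show ?thesis by (simp add: b_def algebra_simps)
  qed
  ultimately show ?thesis by (intro exI[of _ b]) (auto simp: b_def algebra_simps)
qed

text \<open>One realisation of the dynamics: \<open>u k\<close> is the updating agent, \<open>R k\<close> the state it reads and
  \<open>D\<close> the bound on the delays.\<close>

locale asynchronous_run = proximal_network P a
  for P :: "'N::finite \<Rightarrow> 'a::euclidean_space \<Rightarrow> 'a" and a +
  fixes X R :: "nat \<Rightarrow> 'N \<Rightarrow> 'a" and u :: "nat \<Rightarrow> 'N" and D :: nat
  assumes step: "\<And>k j. X (Suc k) j = (if j = u k then response j (R k) else X k j)"
    and own: "\<And>k. R k (u k) = X k (u k)"
    and delayed: "\<And>k j. \<exists>d\<le>D. R k j = X (k - d) j"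
begin

text \<open>Delayed readings only involve the states of the last \<open>D\<close> steps, so the maximal error over this
  window is the quantity that cannot increase. The maximum over agents, unlike a sum, is insensitive
  to the order and the frequency of the updates.\<close>

definition window_error :: "('N \<Rightarrow> 'a) \<Rightarrow> nat \<Rightarrow> real" where
  "window_error xs k = Max ((\<lambda>(d, j). norm (X (k - d) j - xs j)) ` ({..D} \<times> UNIV))"

lemma window_error_le_iff: "window_error xs k \<le> c \<longleftrightarrow> (\<forall>d\<le>D. \<forall>j. norm (X (k - d) j - xs j) \<le> c)"
  unfolding window_error_def by (subst Max_le_iff) auto

lemma window_error_less_iff: "window_error xs k < c \<longleftrightarrow> (\<forall>d\<le>D. \<forall>j. norm (X (k - d) j - xs j) < c)"
  unfolding window_error_def by (subst Max_less_iff) auto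

lemma error_le_window: "d \<le> D \<Longrightarrow> norm (X (k - d) j - xs j) \<le> window_error xs k"
  using window_error_le_iff[of xs k "window_error xs k"] by simp

lemma read_error_le_window: "norm (R k j - xs j) \<le> window_error xs k"
  using delayed[of k j] error_le_window[of _ k j xs] by auto

lemma window_error_decseq:
  assumes "equilibrium xs"
  shows "decseq (window_error xs)"
proof (rule decseq_SucI)
  fix k
  have now: "norm (X (Suc k) j - xs j) \<le> window_error xs k" for j
  proof (cases "j = u k")
    case True
    then show ?thesis
      using response_diff_le[of "R k" xs "window_error xs k" j] read_error_le_window assms
      by (simp add: step equilibrium_def)
  qed (use error_le_window[of 0] in \<open>auto simp: step\<close>)
  show "window_error xs (Suc k) \<le> window_error xs k"
    unfolding window_error_le_iff
  proof (intro allI impI)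
    fix d j assume "d \<le> D"
    then show "norm (X (Suc k - d) j - xs j) \<le> window_error xs k"
      using now error_le_window[of "d - 1" k] by (cases d) auto
  qed
qed

lemma window_error_limit:
  assumes "equilibrium xs"
  obtains c where "window_error xs \<longlonglongrightarrow> c" "\<And>k. c \<le> window_error xs k"
proof -
  have "0 \<le> window_error xs k" for k
    using order.trans[OF norm_ge_zero error_le_window[of 0 k _ xs]] by simp
  then show ?thesis
    using decseq_convergent[OF window_error_decseq[OF assms], of 0] that by blast
qed

lemma converges_if_window_error_small:
  assumes eq: "equilibrium xs" and small: "\<And>\<epsilon>. 0 < \<epsilon> \<Longrightarrow> \<exists>k. window_error xs k < \<epsilon>"
  shows "(\<lambda>k. X k j) \<longlonglongrightarrow> xs j"
proof (rule LIMSEQ_I)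
  fix \<epsilon> :: real assume "0 < \<epsilon>"
  then obtain k where k: "window_error xs k < \<epsilon>" using small by blast
  have "norm (X n j - xs j) < \<epsilon>" if "n \<ge> k" for n
    using error_le_window[of 0 n j xs] decseqD[OF window_error_decseq[OF eq] that] k by simp
  then show "\<exists>k. \<forall>n\<ge>k. norm (X n j - xs j) < \<epsilon>" by blast
qed

text \<open>While one agent updates \<open>D + 1\<close> times in a row, the others stand still, so by the last of these
  updates all delayed readings have caught up with the current state.\<close>

lemma reads_fresh:
  assumes "\<And>r. r \<le> D \<Longrightarrow> u (b + r) = i"
  shows "R (b + D) = X (b + D)"
proof
  fix j
  have idle: "X (b + r) j = X b j" if "j \<noteq> i" "r \<le> Suc D" for r
    using that(2)
  proof (induction r)
    case (Suc r)
    then show ?case using step[of "b + r" j] assms[of r] that(1) by simp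
  qed simp
  show "R (b + D) j = X (b + D) j"
  proof (cases "j = i")
    case True
    then show ?thesis using own[of "b + D"] assms[of D] by simp
  next
    case False
    obtain d where "d \<le> D" "R (b + D) j = X (b + D - d) j" using delayed by blast
    then show ?thesis using idle[OF False, of "D - d"] idle[OF False, of D] by simp
  qed
qed

lemma tendsto_response:
  assumes "\<And>j. (\<lambda>m. z m j) \<longlonglongrightarrow> l j"
  shows "(\<lambda>m. response i (z m)) \<longlonglongrightarrow> response i l"
proof -
  have "isCont (P i) y" for y
    using continuous_on_P continuous_on_eq_continuous_at[OF open_UNIV] by blast
  then show ?thesis
    unfolding response_def by (rule isCont_tendsto_compose) (intro tendsto_intros assms)
qed

text \<open>The error \<open>window_error xs\<close> with respect to some equilibrium \<open>xs\<close> decreases to a limit \<open>c\<close>.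
  Along the occurrences of the word, compactness gives a subsequence on which the finite pieces of
  trajectory converge; their limit \<open>(Y, Q)\<close> is again a run, and its maximal error is \<open>c\<close>
  throughout. It therefore rests at an equilibrium \<open>xb\<close> for a full sweep, which exceeds the window
  length. Hence \<open>window_error xb\<close> tends to \<open>0\<close> along the subsequence, and by monotonicity along the
  whole trajectory.

  The word has one sweep more than \<open>extreme_run_rests_at_equilibrium\<close> inspects. The maximal
  error is attained somewhere in the final window, which lies in the extra sweep, and this
  guarantees that agents with error \<open>c\<close> exist during all earlier sweeps.\<close>

theorem converges_to_equilibrium:
  assumes eq: "equilibrium xs"
    and word: "\<And>n. \<exists>k\<ge>n. \<forall>t<Suc CARD('N) * (Suc D * CARD('N)). u (k + t) = sweep (Suc D) t"
  shows "\<exists>xb. equilibrium xb \<and> (\<forall>j. (\<lambda>k. X k j) \<longlonglongrightarrow> xb j)"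
proof -
  define p where "p = Suc D * CARD('N)"
  define T where "T = Suc CARD('N) * p"
  have "Suc D * 1 \<le> p" unfolding p_def by (intro mult_le_mono2) (simp add: Suc_leI)
  then have D_p: "D < p" by simp
  obtain c where c: "window_error xs \<longlonglongrightarrow> c" "\<And>k. c \<le> window_error xs k"
    using window_error_limit[OF eq] by blast
  obtain k where k: "\<And>n. n \<le> k n" "\<And>n t. t < T \<Longrightarrow> u (k n + t) = sweep (Suc D) t"
    using word unfolding T_def p_def by metis
  define Z where "Z m = (\<lambda>(t, j). (X (k m + t) j, R (k m + t) j))" for m
  have bounded_dist: "bounded (range z)"
    if "\<And>m. norm (z m - y) \<le> C" for z :: "nat \<Rightarrow> 'a" and y C
    unfolding bounded_def using that by (metis dist_norm norm_minus_commute rangeE)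
  have err0: "window_error xs n \<le> window_error xs 0" for n
    using window_error_decseq[OF eq] by (simp add: decseqD)
  have "bounded (range (\<lambda>m. Z m s))" for s
  proof -
    obtain t j where s: "s = (t, j)" by force
    have X: "bounded (range (\<lambda>m. X (k m + t) j))"
      using order.trans[OF error_le_window[of 0 _ j xs] err0] by (intro bounded_dist[of _ "xs j"]) auto
    have R: "bounded (range (\<lambda>m. R (k m + t) j))"
      using order.trans[OF read_error_le_window err0] by (intro bounded_dist[of _ "xs j"]) auto
    show ?thesis
      using bounded_Times[OF X R] by (rule bounded_subset) (auto simp: Z_def s)
  qed
  then obtain l r where r: "strict_mono r"
      and l: "\<And>s. s \<in> {..T} \<times> UNIV \<Longrightarrow> (\<lambda>m. Z (r m) s) \<longlonglongrightarrow> l s"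
    using finite_family_convergent_subsequence[of "{..T} \<times> UNIV" Z,
        OF finite_cartesian_product[OF finite_atMost finite]] by blast
  define Y where "Y t j = fst (l (t, j))" for t j
  define Q where "Q t j = snd (l (t, j))" for t j
  have XY: "(\<lambda>m. X (k (r m) + t) j) \<longlonglongrightarrow> Y t j" if "t \<le> T" for t j
    using tendsto_fst[OF l[of "(t, j)"]] that by (simp add: Z_def Y_def)
  have RQ: "(\<lambda>m. R (k (r m) + t) j) \<longlonglongrightarrow> Q t j" if "t \<le> T" for t j
    using tendsto_snd[OF l[of "(t, j)"]] that by (simp add: Z_def Q_def)
  have "filterlim (\<lambda>m. k (r m) + t) sequentially sequentially" for t
  proof (rule filterlim_at_top_mono[OF filterlim_ident], intro always_eventually allI)
    fix m show "m \<le> k (r m) + t" using k(1)[of "r m"] seq_suble[OF r, of m] by simp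
  qed
  then have win: "(\<lambda>m. window_error xs (k (r m) + t)) \<longlonglongrightarrow> c" for t
    by (rule filterlim_compose[OF c(1)])
  have Y_bound: "norm (Y t j - xs j) \<le> c" if "t \<le> T" for t j
    by (rule LIMSEQ_le[OF tendsto_norm[OF tendsto_diff[OF XY[OF that] tendsto_const]] win[of t]])
      (use error_le_window[of 0] in auto)
  have Q_bound: "norm (Q t j - xs j) \<le> c" if "t \<le> T" for t j
    by (rule LIMSEQ_le[OF tendsto_norm[OF tendsto_diff[OF RQ[OF that] tendsto_const]] win[of t]])
      (use read_error_le_window in auto)
  have Y_step: "Y (Suc t) j = (if j = sweep (Suc D) t then response j (Q t) else Y t j)" if t: "t < T" for t j
  proof (rule LIMSEQ_unique)
    show "(\<lambda>m. X (k (r m) + Suc t) j) \<longlonglongrightarrow> Y (Suc t) j" using XY[of "Suc t" j] t by simp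
    show "(\<lambda>m. X (k (r m) + Suc t) j) \<longlonglongrightarrow> (if j = sweep (Suc D) t then response j (Q t) else Y t j)"
      using XY[of t j] tendsto_response[where z = "\<lambda>m. R (k (r m) + t)" and l = "Q t" and i = j, OF RQ[of t]] t
      by (auto simp: step k(2))
  qed
  have Y_own: "Q t (sweep (Suc D) t) = Y t (sweep (Suc D) t)" if t: "t < T" for t
    using XY[of t "sweep (Suc D) t"] RQ[of t "sweep (Suc D) t"] t own[of "k (r _) + t"]
    by (intro LIMSEQ_unique[of _ "Q t _"]) (auto simp: k(2))
  have Y_fresh: "\<exists>t. s * p \<le> t \<and> t < Suc s * p \<and> sweep (Suc D) t = i \<and> Q t = Y t" if s: "s < CARD('N)" for s and i :: 'N
  proof -
    obtain b where b: "s * p \<le> b" "b + Suc D \<le> Suc s * p" "\<And>q. q < Suc D \<Longrightarrow> sweep (Suc D) (b + q) = i"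
      using sweep_visits_all[of "Suc D" s i] unfolding p_def by auto
    have "Suc s * p \<le> T" unfolding T_def using s by (intro mult_le_mono1) simp
    then have bT: "b + q < T" if "q \<le> D" for q using b(2) that by simp
    have "R (k m + b + D) = X (k m + b + D)" for m
      using k(2)[OF bT] b(3) by (intro reads_fresh[of _ i]) (simp add: add.assoc)
    then have "Q (b + D) j = Y (b + D) j" for j
      using XY[of "b + D" j] RQ[of "b + D" j] bT[of D]
      by (intro LIMSEQ_unique[of _ "Q (b + D) j"]) (auto simp: add.assoc)
    then show ?thesis using b by (intro exI[of _ "b + D"]) auto
  qed
  have Y_top: "\<exists>t j. CARD('N) * p \<le> t \<and> t \<le> T \<and> c \<le> norm (Y t j - xs j)"
  proof (rule ccontr)
    \<comment> \<open>Errors below \<open>c\<close> in the whole final window would push \<open>window_error xs\<close> below its limit.\<close>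
    assume no: "\<not> ?thesis"
    have ev: "eventually (\<lambda>m. \<forall>d\<in>{..D}. \<forall>j\<in>UNIV. norm (X (k (r m) + (T - d)) j - xs j) < c) sequentially"
    proof (intro eventually_ball_finite ballI)
      fix d j assume "d \<in> {..D}"
      then have "CARD('N) * p \<le> T - d" using D_p by (simp add: T_def)
      then have "norm (Y (T - d) j - xs j) < c"
        using no by (meson diff_le_self not_le)
      then show "eventually (\<lambda>m. norm (X (k (r m) + (T - d)) j - xs j) < c) sequentially"
        by (intro order_tendstoD(2)[OF tendsto_norm[OF tendsto_diff[OF XY tendsto_const]]]) auto
    qed auto
    obtain m where m: "\<forall>d\<le>D. \<forall>j. norm (X (k (r m) + (T - d)) j - xs j) < c"
      using eventually_happens'[OF sequentially_bot ev] by auto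
    have "k (r m) + (T - d) = k (r m) + T - d" if "d \<le> D" for d
      using that D_p by (simp add: T_def)
    then have "window_error xs (k (r m) + T) < c"
      unfolding window_error_less_iff using m by metis
    then show False using c(2) by (simp add: not_le[symmetric])
  qed
  have N_T: "CARD('N) * p \<le> T" by (simp add: T_def)
  have "\<exists>s<CARD('N). equilibrium (Y (s * p)) \<and> (\<forall>t\<in>{s * p..Suc s * p}. Y t = Y (s * p))"
    by (rule extreme_run_rests_at_equilibrium[where R = Q and u = "sweep (Suc D)",
        OF eq Y_step Y_own Q_bound[OF less_imp_le] Y_bound Y_fresh N_T Y_top])
  then obtain s where s: "s < CARD('N)" "equilibrium (Y (s * p))"
      "\<And>t. t \<in> {s * p..Suc s * p} \<Longrightarrow> Y t = Y (s * p)"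
    by blast
  let ?xb = "Y (s * p)" and ?t = "Suc s * p"
  have t_T: "?t \<le> T" unfolding T_def using s(1) by (intro mult_le_mono1) simp
  have "\<exists>n. window_error ?xb n < \<epsilon>" if \<epsilon>: "0 < \<epsilon>" for \<epsilon>
  proof -
    have ev: "eventually (\<lambda>m. \<forall>d\<in>{..D}. \<forall>j\<in>UNIV. norm (X (k (r m) + (?t - d)) j - ?xb j) < \<epsilon>) sequentially"
    proof (intro eventually_ball_finite ballI)
      fix d j assume "d \<in> {..D}"
      then have "Y (?t - d) = ?xb" using D_p by (intro s(3)) auto
      then have "(\<lambda>m. X (k (r m) + (?t - d)) j) \<longlonglongrightarrow> ?xb j"
        using XY[of "?t - d" j] t_T by simp
      then show "eventually (\<lambda>m. norm (X (k (r m) + (?t - d)) j - ?xb j) < \<epsilon>) sequentially"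
        using LIMSEQ_D[OF _ \<epsilon>] by (force simp: eventually_sequentially)
    qed auto
    obtain m where m: "\<forall>d\<le>D. \<forall>j. norm (X (k (r m) + (?t - d)) j - ?xb j) < \<epsilon>"
      using eventually_happens'[OF sequentially_bot ev] by auto
    have "k (r m) + (?t - d) = k (r m) + ?t - d" if "d \<le> D" for d
      using that D_p by simp
    then have "window_error ?xb (k (r m) + ?t) < \<epsilon>"
      unfolding window_error_less_iff using m by metis
    then show ?thesis by blast
  qed
  then show ?thesis using converges_if_window_error_small[OF s(2)] s(2) by blast
qed

end

section \<open>Occurrence of words in independent sequences\<close>

text \<open>The converse Borel-Cantelli argument: cut the time axis into consecutive blocks of length \<open>T\<close>.
  The blocks are independent and each spells the word with probability at least \<open>\<epsilon> ^ T\<close>, so from any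
  time on, the probability that the next \<open>l\<close> blocks all miss it decays geometrically in \<open>l\<close>.\<close>

lemma (in prob_space) word_occurs_infinitely_often:
  fixes \<zeta> :: "nat \<Rightarrow> 'a \<Rightarrow> 'b" and w :: "nat \<Rightarrow> 'b" and T :: nat and \<epsilon> :: real
  assumes indep: "indep_vars (\<lambda>_. N) \<zeta> UNIV"
    and sets: "\<And>r. {w r} \<in> sets N"
    and \<epsilon>: "0 < \<epsilon>" "\<And>k r. \<epsilon> \<le> prob {\<omega> \<in> space M. \<zeta> k \<omega> = w r}"
  shows "AE \<omega> in M. \<forall>n. \<exists>k\<ge>n. \<forall>r<T. \<zeta> (k + r) \<omega> = w r"
proof (cases "T = 0")
  case False
  define K where "K m = {m * T..<m * T + T}" for m
  define W where "W m = PiE (K m) (\<lambda>k. {w (k - m * T)})" for m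
  define \<xi> where "\<xi> m \<omega> = restrict (\<lambda>k. \<zeta> k \<omega>) (K m)" for m \<omega>
  have disj: "disjoint_family_on K UNIV"
  proof (unfold disjoint_family_on_def, safe)
    fix m n k assume "m \<noteq> n" "k \<in> K m" "k \<in> K n"
    moreover have "k div T = m" if "k \<in> K m" for k m
      using that False by (intro div_nat_eqI) (auto simp: K_def algebra_simps)
    ultimately show "k \<in> {}" by blast
  qed
  have block_indep: "indep_vars (\<lambda>m. PiM (K m) (\<lambda>_. N)) \<xi> UNIV"
    unfolding \<xi>_def by (rule indep_vars_restrict[OF indep _ disj]) auto
  have W_sets: "W m \<in> sets (PiM (K m) (\<lambda>_. N))" for m
    unfolding W_def by (intro sets_PiM_I_finite sets) (auto simp: K_def)
  define hit where "hit m = \<xi> m -` W m \<inter> space M" for m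
  have hit_eq: "hit m = {\<omega> \<in> space M. \<forall>r<T. \<zeta> (m * T + r) \<omega> = w r}" for m
  proof -
    have "(\<forall>k\<in>K m. \<zeta> k \<omega> = w (k - m * T)) \<longleftrightarrow> (\<forall>r<T. \<zeta> (m * T + r) \<omega> = w r)" for \<omega>
    proof safe
      fix k assume "\<forall>r<T. \<zeta> (m * T + r) \<omega> = w r" "k \<in> K m"
      then show "\<zeta> k \<omega> = w (k - m * T)"
        by (metis K_def add_diff_inverse_nat atLeastLessThan_iff leD nat_add_left_cancel_less)
    qed (auto simp: K_def)
    then show ?thesis by (auto simp: hit_def W_def \<xi>_def PiE_iff extensional_def)
  qed
  have \<xi>_meas: "\<xi> m \<in> measurable M (PiM (K m) (\<lambda>_. N))" for m
    using block_indep by (auto simp: indep_vars_def)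
  have hit_sets: "hit m \<in> events" for m
    unfolding hit_def using \<xi>_meas W_sets by (rule measurable_sets)
  have hit_prob: "\<epsilon> ^ T \<le> prob (hit m)" for m
  proof -
    have "hit m = (\<Inter>k\<in>K m. \<zeta> k -` {w (k - m * T)} \<inter> space M)"
      using False by (auto simp: hit_def W_def \<xi>_def PiE_iff K_def)
    moreover have "prob (\<Inter>k\<in>K m. \<zeta> k -` {w (k - m * T)} \<inter> space M)
        = (\<Prod>k\<in>K m. prob (\<zeta> k -` {w (k - m * T)} \<inter> space M))"
      using False by (intro indep_varsD[OF indep] sets) (auto simp: K_def)
    moreover have "(\<Prod>k\<in>K m. \<epsilon>) \<le> (\<Prod>k\<in>K m. prob (\<zeta> k -` {w (k - m * T)} \<inter> space M))"
    proof (rule prod_mono)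
      fix k
      have "\<zeta> k -` {w (k - m * T)} \<inter> space M = {\<omega> \<in> space M. \<zeta> k \<omega> = w (k - m * T)}" by auto
      then show "0 \<le> \<epsilon> \<and> \<epsilon> \<le> prob (\<zeta> k -` {w (k - m * T)} \<inter> space M)"
        using \<epsilon> by (simp add: less_imp_le)
    qed
    ultimately show ?thesis by (simp add: K_def)
  qed
  define q where "q = 1 - \<epsilon> ^ T"
  have q: "0 \<le> q" "q < 1"
    using order.trans[OF hit_prob[of 0] prob_le_1] \<epsilon>(1) by (auto simp: q_def)
  have hit_after: "AE \<omega> in M. \<exists>m\<ge>n. \<omega> \<in> hit m" for n
  proof -
    define miss where "miss l = (\<Inter>m\<in>{n..n + l}. \<xi> m -` (space (PiM (K m) (\<lambda>_. N)) - W m) \<inter> space M)" for l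
    have compl: "\<xi> m -` (space (PiM (K m) (\<lambda>_. N)) - W m) \<inter> space M = space M - hit m" for m
      using \<xi>_meas[of m] by (auto simp: hit_def dest: measurable_space)
    have "prob (miss l) \<le> q ^ Suc l" for l
    proof -
      have "prob (miss l) = (\<Prod>m\<in>{n..n + l}. prob (\<xi> m -` (space (PiM (K m) (\<lambda>_. N)) - W m) \<inter> space M))"
        unfolding miss_def using W_sets by (intro indep_varsD[OF block_indep]) auto
      also have "\<dots> \<le> (\<Prod>m\<in>{n..n + l}. q)"
        using hit_prob by (intro prod_mono) (simp add: compl prob_compl hit_sets q_def)
      finally show ?thesis by simp
    qed
    then have le: "prob (\<Inter>m\<in>{n..}. space M - hit m) \<le> q ^ Suc l" for l
    proof -
      have "prob (\<Inter>m\<in>{n..}. space M - hit m) \<le> prob (miss l)"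
        unfolding miss_def compl using hit_sets
        by (intro finite_measure_mono) (auto intro!: sets.finite_INT)
      also have "\<dots> \<le> q ^ Suc l" by fact
      finally show ?thesis .
    qed
    have "prob (\<Inter>m\<in>{n..}. space M - hit m) \<le> 0"
    proof (rule LIMSEQ_le_const)
      show "(\<lambda>l. q ^ Suc l) \<longlonglongrightarrow> 0" using q by (intro LIMSEQ_Suc LIMSEQ_power_zero) auto
    qed (use le in auto)
    then have "prob (\<Inter>m\<in>{n..}. space M - hit m) = 0"
      using measure_nonneg[of M] by (simp add: antisym)
    moreover have "(\<Inter>m\<in>{n..}. space M - hit m) \<in> events"
      using hit_sets by (intro sets.countable_INT') auto
    ultimately have "AE \<omega> in M. \<omega> \<notin> (\<Inter>m\<in>{n..}. space M - hit m)"
      by (simp add: prob_eq_0)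
    then show ?thesis by (rule AE_mp) (auto intro!: AE_I2)
  qed
  have "AE \<omega> in M. \<forall>n. \<exists>m\<ge>n. \<omega> \<in> hit m"
    using hit_after by (simp add: AE_all_countable)
  then show ?thesis
  proof (rule AE_mp, intro AE_I2 impI allI)
    fix \<omega> n assume "\<forall>n. \<exists>m\<ge>n. \<omega> \<in> hit m"
    then obtain m where m: "m \<ge> n" "\<omega> \<in> hit m" by blast
    have "n \<le> m * T" using m(1) False by (simp add: trans_le_add1 order.trans[of n m "m * T"])
    then show "\<exists>k\<ge>n. \<forall>r<T. \<zeta> (k + r) \<omega> = w r"
      using m(2) hit_eq by blast
  qed
qed auto

section \<open>Stacked vectors\<close>

lemma block_col [simp]: "block i (col z) = z i"
  by (simp add: block_def col_def vec_eq_iff)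

lemma block_add [simp]: "block i (x + y) = block i x + block i y"
  by (simp add: block_def vec_eq_iff)

lemma block_diff [simp]: "block i (x - y) = block i x - block i y"
  by (simp add: block_def vec_eq_iff)

lemma block_scaleR [simp]: "block i (r *\<^sub>R x) = r *\<^sub>R block i x"
  by (simp add: block_def vec_eq_iff)

lemma stacked_eq_iff: "x = y \<longleftrightarrow> (\<forall>i. block i x = block i y)"
  by (auto simp: block_def vec_eq_iff)

lemma continuous_on_block [continuous_intros]:
  "continuous_on S f \<Longrightarrow> continuous_on S (\<lambda>x. block i (f x))"
  unfolding block_def by (intro continuous_intros)

lemma continuous_on_col [continuous_intros]:
  assumes "\<And>i. continuous_on S (f i)"
  shows "continuous_on S (\<lambda>x. col (\<lambda>i. f i x))"
  unfolding col_def by (intro continuous_intros assms)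

lemma tendsto_stacked:
  fixes l :: "real ^ ('N::finite \<times> 'n::finite)"
  assumes "\<And>i. ((\<lambda>k. block i (x k)) \<longlongrightarrow> block i l) F"
  shows "(x \<longlongrightarrow> l) F"
proof (rule vec_tendstoI)
  fix ic :: "'N \<times> 'n"
  show "((\<lambda>k. x k $ ic) \<longlongrightarrow> l $ ic) F"
    using tendsto_vec_nth[OF assms[of "fst ic"], of "snd ic"] by (simp add: block_def)
qed

lemma block_kron_mat_1: "block i ((B \<otimes>\<^sub>K mat 1) *v x) = (\<Sum>j\<in>UNIV. B $ i $ j *\<^sub>R block j x)"
proof -
  have "(\<Sum>s\<in>UNIV. B $ i $ fst s * mat 1 $ c $ snd s * x $ s) = (\<Sum>j\<in>UNIV. B $ i $ j * x $ (j, c))" for c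
  proof -
    have "(\<Sum>s\<in>UNIV. B $ i $ fst s * mat 1 $ c $ snd s * x $ s)
        = (\<Sum>j\<in>UNIV. \<Sum>d\<in>UNIV. B $ i $ j * mat 1 $ c $ d * x $ (j, d))"
      unfolding sum.cartesian_product UNIV_Times_UNIV by (simp add: case_prod_unfold)
    also have "\<dots> = (\<Sum>j\<in>UNIV. B $ i $ j * x $ (j, c))"
      by (simp add: mat_def if_distrib[of "\<lambda>r. _ * r * _"] cong: if_cong)
    finally show ?thesis .
  qed
  then show ?thesis
    by (simp add: vec_eq_iff block_def kron_def matrix_vector_mult_def)
qed

lemma block_Select: "block j (Select i *v x) = (if j = i then block i x else 0)"
proof -
  have "(\<Sum>l\<in>UNIV. (if j = i \<and> l = i then 1 else 0) *\<^sub>R block l x) = (if j = i then block i x else 0)"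
    by (cases "j = i") (simp_all add: if_distrib[of "\<lambda>r. r *\<^sub>R _"] cong: if_cong)
  then show ?thesis
    unfolding Select_def block_kron_mat_1 by (simp add: select_mat_def)
qed

lemma inj_Select: "inj (Select :: 'N::finite \<Rightarrow> real ^ ('N \<times> 'n::finite) ^ ('N \<times> 'n))"
proof
  fix i j :: 'N assume eq: "Select i = (Select j :: real ^ ('N \<times> 'n) ^ ('N \<times> 'n))"
  have "block i (Select i *v (1 :: real ^ ('N \<times> 'n))) = block i (Select j *v 1)" by (simp add: eq)
  moreover have "block i (1 :: real ^ ('N \<times> 'n)) \<noteq> 0" by (simp add: block_def vec_eq_iff)
  ultimately show "i = j"
    by (auto simp: block_Select split: if_splits)
qed

lemma compact_stacked:
  fixes \<Omega> :: "'N::finite \<Rightarrow> (real ^ 'n::finite) set"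
  assumes "\<And>i. compact (\<Omega> i)"
  shows "compact {x. \<forall>i. block i x \<in> \<Omega> i}"
  unfolding compact_eq_bounded_closed
proof
  have "closed (block i -` \<Omega> i)" for i
    using assms by (intro closed_vimage compact_imp_closed continuous_intros)
  then have "closed {x. block i x \<in> \<Omega> i}" for i
    by (simp add: vimage_def)
  then show "closed {x. \<forall>i. block i x \<in> \<Omega> i}"
    by (rule closed_Collect_all)
  obtain B where B: "\<And>i y. y \<in> \<Omega> i \<Longrightarrow> norm y \<le> B i"
    using compact_imp_bounded[OF assms] unfolding bounded_iff by metis
  show "bounded {x. \<forall>i. block i x \<in> \<Omega> i}"
    unfolding bounded_iff
  proof (intro exI ballI)
    fix x assume x: "x \<in> {x. \<forall>i. block i x \<in> \<Omega> i}"
    have "norm x \<le> (\<Sum>ic\<in>UNIV. \<bar>x $ ic\<bar>)" by (rule norm_le_l1_cart)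
    also have "\<dots> \<le> (\<Sum>ic\<in>(UNIV :: ('N \<times> 'n) set). B (fst ic))"
    proof (rule sum_mono)
      fix ic :: "'N \<times> 'n"
      have "\<bar>x $ ic\<bar> = \<bar>block (fst ic) x $ snd ic\<bar>" by (simp add: block_def)
      also have "\<dots> \<le> norm (block (fst ic) x)" by (rule component_le_norm_cart)
      also have "\<dots> \<le> B (fst ic)" using x by (intro B) auto
      finally show "\<bar>x $ ic\<bar> \<le> B (fst ic)" .
    qed
    finally show "norm x \<le> (\<Sum>ic\<in>(UNIV :: ('N \<times> 'n) set). B (fst ic))" .
  qed
qed

text \<open>Brouwer's theorem on the product of the sets \<open>\<Omega> i\<close>. It supplies the equilibrium from which the
  errors of a trajectory are first measured.\<close>

lemma stacked_fixed_point_exists: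
  fixes \<Omega> :: "'N::finite \<Rightarrow> (real ^ 'n::finite) set"
  assumes \<Omega>: "\<And>i. \<Omega> i \<noteq> {}" "\<And>i. compact (\<Omega> i)" "\<And>i. convex (\<Omega> i)"
    and cont: "\<And>i. continuous_on UNIV (G i)" and range: "\<And>i x. G i x \<in> \<Omega> i"
  shows "\<exists>x. \<forall>i. G i x = block i x"
proof -
  let ?S = "{x. \<forall>i. block i x \<in> \<Omega> i}" and ?T = "\<lambda>x. col (\<lambda>i. G i x)"
  obtain w where "\<forall>i. w i \<in> \<Omega> i" using bchoice[of UNIV "\<lambda>i y. y \<in> \<Omega> i"] \<Omega>(1) by auto
  then have nonempty: "?S \<noteq> {}" by (auto intro!: exI[of _ "col w"])
  have convex: "convex ?S" using \<Omega>(3) by (auto simp: convex_def)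
  have cont: "continuous_on ?S ?T"
    using cont by (intro continuous_on_col) (auto intro: continuous_on_subset)
  have maps: "?T \<in> ?S \<rightarrow> ?S" using range by simp
  obtain x where "?T x = x"
    using brouwer[OF compact_stacked[of \<Omega>, OF \<Omega>(2)] convex nonempty cont maps] by blast
  then show ?thesis by (metis block_col)
qed

lemma strongly_connected_imp_paths:
  assumes "strongly_connected (with_proj (assoc_digraph A))"
  shows "(i, j) \<in> {(j, i). 0 < A $ i $ j}\<^sup>*"
proof -
  have "(i, j) \<in> rtrancl_on UNIV {(j, i). 0 < A $ i $ j}"
    using assms by (simp add: strongly_connected_def reachable_def assoc_digraph_def)
  then show ?thesis by (induction rule: rtrancl_on_induct)
      (auto intro: rtrancl_into_rtrancl)
qed

section \<open>Almost sure convergence to a network equilibrium\<close>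

theorem theorem2:
  fixes \<Omega> :: "'N::finite \<Rightarrow> (real ^ 'n::finite) set"
    and f :: "'N \<Rightarrow> real ^ 'n \<Rightarrow> ereal"
    and A :: "real ^ 'N ^ 'N"
    and a_min p_min :: real
    and p :: "'N \<Rightarrow> real"
    and M :: "'w measure"
    and \<zeta> :: "nat \<Rightarrow> 'w \<Rightarrow> real ^ ('N \<times> 'n) ^ ('N \<times> 'n)"
    and \<phi> :: "'N \<Rightarrow> nat \<Rightarrow> 'w \<Rightarrow> nat"
    and \<phi>_max :: nat
    and x0 :: "real ^ ('N \<times> 'n)"
    and x :: "nat \<Rightarrow> 'w \<Rightarrow> real ^ ('N \<times> 'n)"
  defines "fbar \<equiv> \<lambda>i. constrained (f i) (\<Omega> i)"
  assumes \<Omega>: "\<And>i. \<Omega> i \<noteq> {}" "\<And>i. compact (\<Omega> i)" "\<And>i. convex (\<Omega> i)"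
    and f_range: "\<And>i y. f i y \<noteq> -\<infinity>"
    and fbar: "\<And>i. proper_fun (fbar i)" "\<And>i. lsc_fun (fbar i)" "\<And>i. convex_fun (fbar i)"
    and A_stochastic: "row_stochastic A"
    and a_min: "a_min = (MIN i. A $ i $ i)" "0 < a_min"
    and A_connected: "strongly_connected (with_proj (assoc_digraph A))"
    and prob: "prob_space M"
    and p_distr: "\<And>i. 0 \<le> p i" "(\<Sum>i\<in>UNIV. p i) = 1"
    and p_min: "p_min = (MIN i. p i)" "0 < p_min"
    and \<zeta>_values: "\<And>k \<omega>. \<omega> \<in> space M \<Longrightarrow> \<zeta> k \<omega> \<in> range Select"
    and \<zeta>_indep: "prob_space.indep_vars M (\<lambda>_. borel) \<zeta> UNIV"
    and \<zeta>_distr: "\<And>k i. measure M {\<omega> \<in> space M. \<zeta> k \<omega> = Select i} = p i"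
    and \<phi>_measurable: "\<And>j k. \<phi> j k \<in> measurable M (count_space UNIV)"
    and \<phi>_bounded: "\<And>j k \<omega>. \<omega> \<in> space M \<Longrightarrow> \<phi> j k \<omega> \<le> \<phi>_max"
    and \<phi>_max: "ereal (real \<phi>_max) < delay_bound CARD('N) a_min p_min"
    and x0: "\<And>i. block i x0 \<in> \<Omega> i"
    and x_init: "\<And>\<omega>. \<omega> \<in> space M \<Longrightarrow> x 0 \<omega> = x0"
    and x_step: "\<And>k \<omega>. \<omega> \<in> space M \<Longrightarrow>
      x (Suc k) \<omega> = x k \<omega> + \<zeta> k \<omega> *v
        (Prox fbar ((A \<otimes>\<^sub>K mat 1) *v read_state \<zeta> \<phi> x k \<omega>) - read_state \<zeta> \<phi> x k \<omega>)"
  shows "AE \<omega> in M. \<exists>xbar. xbar \<in> fixed_points (Prox fbar \<circ> (\<lambda>y. (A \<otimes>\<^sub>K mat 1) *v y)) \<and>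
           network_equilibrium A fbar xbar \<and> (\<lambda>k. x k \<omega>) \<longlonglongrightarrow> xbar"
proof -
  interpret prob_space M by (rule prob)
  have agent: "prox_function (fbar i) (\<Omega> i)" for i
  proof
    show "fbar i y = \<infinity>" if "y \<notin> \<Omega> i" for y
      using that f_range by (simp add: fbar_def constrained_def indicator_fun_def)
  qed (use fbar \<Omega> in auto)
  have A_diag: "0 < A $ i $ i" for i
    using a_min by (simp add: Min_gr_iff)
  interpret net: proximal_network "\<lambda>i. prox (fbar i)" "\<lambda>i j. A $ i $ j"
    by standard (use prox_function.prox_firmly_nonexpansive[OF agent] A_stochastic A_diag
        strongly_connected_imp_paths[OF A_connected] in \<open>auto simp: row_stochastic_def\<close>)
  have response: "block i (Prox fbar ((A \<otimes>\<^sub>K mat 1) *v y)) = net.response i (\<lambda>j. block j y)" for i y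
    by (simp add: Prox_def block_kron_mat_1 net.response_def)
  have fixed: "y \<in> fixed_points (Prox fbar \<circ> (\<lambda>y. (A \<otimes>\<^sub>K mat 1) *v y))" and nwe: "network_equilibrium A fbar y"
    if "net.equilibrium (\<lambda>i. block i y)" for y
    using that prox_function.agent_cost_minimisers[OF agent]
    by (auto simp: fixed_points_def network_equilibrium_def stacked_eq_iff response
        net.equilibrium_def net.response_def)
  obtain xs where xs: "net.equilibrium (\<lambda>i. block i xs)"
  proof -
    have "continuous_on UNIV (\<lambda>y. net.response i (\<lambda>j. block j y))" for i
      unfolding net.response_def
      by (rule continuous_on_compose2[OF net.continuous_on_P]) (auto intro!: continuous_intros)
    moreover have "net.response i z \<in> \<Omega> i" for i z
      unfolding net.response_def by (rule prox_function.prox_in[OF agent])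
    ultimately obtain y where "\<And>i. net.response i (\<lambda>j. block j y) = block i y"
      using stacked_fixed_point_exists[of \<Omega> "\<lambda>i y. net.response i (\<lambda>j. block j y)", OF \<Omega>] by blast
    then show ?thesis by (intro that[of y]) (simp add: net.equilibrium_def)
  qed
  let ?w = "sweep (Suc \<phi>_max) :: nat \<Rightarrow> 'N"
  have "AE \<omega> in M. \<forall>n. \<exists>k\<ge>n. \<forall>t<Suc CARD('N) * (Suc \<phi>_max * CARD('N)). \<zeta> (k + t) \<omega> = Select (?w t)"
  proof (rule word_occurs_infinitely_often[OF \<zeta>_indep _ p_min(2)])
    show "p_min \<le> prob {\<omega> \<in> space M. \<zeta> k \<omega> = Select (?w t)}" for k t
      by (simp add: \<zeta>_distr p_min(1))
  qed auto
  then show ?thesis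
  proof (rule AE_mp, intro AE_I2 impI)
    fix \<omega> assume \<omega>: "\<omega> \<in> space M"
      and word: "\<forall>n. \<exists>k\<ge>n. \<forall>t<Suc CARD('N) * (Suc \<phi>_max * CARD('N)). \<zeta> (k + t) \<omega> = Select (?w t)"
    \<comment> \<open>From here on, one trajectory is fixed and the argument is deterministic.\<close>
    define u where "u k = the_inv (Select :: 'N \<Rightarrow> real ^ ('N \<times> 'n) ^ ('N \<times> 'n)) (\<zeta> k \<omega>)" for k
    have \<zeta>: "\<zeta> k \<omega> = Select i \<longleftrightarrow> i = u k" for k i
      using \<zeta>_values[OF \<omega>, of k] by (auto simp: u_def the_inv_f_f[OF inj_Select] inj_eq[OF inj_Select])
    define X where "X k j = block j (x k \<omega>)" for k j
    define R where "R k j = block j (read_state \<zeta> \<phi> x k \<omega>)" for k j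
    have R: "R k j = (if j = u k then X k j else X (k - \<phi> j k \<omega>) j)" for k j
      by (simp add: R_def X_def read_state_def \<zeta>)
    interpret run: asynchronous_run "\<lambda>i. prox (fbar i)" "\<lambda>i j. A $ i $ j" X R u \<phi>_max
    proof
      show "R k (u k) = X k (u k)" for k by (simp add: R)
      show "\<exists>d\<le>\<phi>_max. R k j = X (k - d) j" for k j
        using \<phi>_bounded[OF \<omega>, of j k] by (auto simp: R intro: exI[of _ 0])
      fix k j
      have "\<zeta> k \<omega> = Select (u k)" by (simp add: \<zeta>)
      then have "X (Suc k) j = X k j + (if j = u k then net.response j (R k) - R k j else 0)"
        by (simp add: X_def R_def[abs_def] x_step[OF \<omega>] block_Select response)
      then show "X (Suc k) j = (if j = u k then net.response j (R k) else X k j)"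
        by (simp add: R)
    qed
    have "\<exists>k\<ge>n. \<forall>t<Suc CARD('N) * (Suc \<phi>_max * CARD('N)). u (k + t) = ?w t" for n
      using word by (metis \<zeta>)
    from run.converges_to_equilibrium[OF xs this]
    obtain xb where xb: "net.equilibrium xb" "\<And>j. (\<lambda>k. X k j) \<longlonglongrightarrow> xb j" by blast
    have "(\<lambda>k. x k \<omega>) \<longlonglongrightarrow> col xb"
      using xb(2) by (intro tendsto_stacked) (simp add: X_def)
    moreover have "net.equilibrium (\<lambda>i. block i (col xb))" using xb(1) by simp
    ultimately show "\<exists>xbar. xbar \<in> fixed_points (Prox fbar \<circ> (\<lambda>y. (A \<otimes>\<^sub>K mat 1) *v y)) \<and>
           network_equilibrium A fbar xbar \<and> (\<lambda>k. x k \<omega>) \<longlonglongrightarrow> xbar"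
      using fixed nwe by blast
  qed
qed

end
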